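(* Let $\mathcal D=\mathrm{Unif}(\{-1,0,1\}^d)$ with $d\ge2$, $x^*=e_1$ (the first canonical basis vector), $\sigma(s)=\max\{s,0\}$, and $f_2(x)=\mathbb{E}_{z\sim\mathcal D}[\tfrac12(\sigma(x\cdot z)-\sigma(x^*\cdot z))^2]$ for $x\in\mathbb{S}^{d-1}$. For $\rho>0$ let $\mathcal S_{x^*}(\rho)=\{x\in\mathbb{S}^{d-1}:\theta(x,x^* )\le\rho\}$. Then $f_2$ is not geodesically convex on $\mathcal S_{x^*}(2/\sqrt d)$, whereas $f_2$ is $\sqrt3/72$-RGA on $(\mathcal S_{x^*}(\arctan(\sqrt3/36)),x^* )$.
   Context: $\mathbb{S}^{d-1}$ is the unit sphere of $\mathbb{R}^d$; $\theta(x,y)=\arccos(x\cdot y)$ for unit vectors (also the geodesic distance). A function $f$ on a subset $\mathcal X\subset\mathbb{S}^{d-1}$ is geodesically convex if for every minimizing geodesic $\mathcal G_{x,y}:[0,1]\to\mathcal X$ from $x$ to $y$ (great-circle arc, constant speed), $f(\mathcal G_{x,y}(t))\le(1-t)f(x)+tf(y)$ for all $t\in[0,1]$. For a locally Lipschitz $f$, $\partial^Cf(x)$ is the Clarke subdifferential (convex hull of limits of gradients at differentiability points $y_k\to x$) and $\partial^{C,R}f(x)=\{(I-xx^\top)\xi:\xi\in\partial^Cf(x)\}$. $f$ is $\mu$-RGA on $(\mathcal X,x^* )$ if for every $x\in\mathcal X$, every $g(x)\in\partial^{C,R}f(x)$ satisfies: $g(x)\neq0$ whenever $x\neq x^*$,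 and $g(x)\cdot x^*\le-\mu\,\sin(\theta(x,x^* ))\,\|g(x)\|_2$. *)

theory Defs
  imports "HOL-Probability.Probability"
begin

definition sphere_angle :: "'a::real_inner \<Rightarrow> 'a \<Rightarrow> real" where
  "sphere_angle x y = arccos (x \<bullet> y)"

definition spherical_cap :: "'a::real_inner \<Rightarrow> real \<Rightarrow> 'a set" where
  "spherical_cap xs \<rho> = {x \<in> sphere 0 1. sphere_angle x xs \<le> \<rho>}"

text \<open>The great-circle arc from \<open>x\<close> to \<open>y\<close> with unit initial direction \<open>v\<close>, run at constant
  speed \<open>sphere_angle x y\<close>: its length is then the geodesic distance, so it is minimizing.
  For antipodal endpoints every direction \<open>v\<close> is admitted. Values of \<open>G\<close> outside
  \<open>{0..1}\<close> are irrelevant.\<close>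

definition minimizing_geodesic :: "(real \<Rightarrow> 'a::real_inner) \<Rightarrow> 'a \<Rightarrow> 'a \<Rightarrow> bool" where
  "minimizing_geodesic G x y \<longleftrightarrow>
     x \<in> sphere 0 1 \<and> y \<in> sphere 0 1 \<and> G 0 = x \<and> G 1 = y \<and>
     (\<exists>v. norm v = 1 \<and> v \<bullet> x = 0 \<and>
        (\<forall>t\<in>{0..1}. G t = cos (t * sphere_angle x y) *\<^sub>R x + sin (t * sphere_angle x y) *\<^sub>R v))"

definition geodesically_convex_on :: "'a::real_inner set \<Rightarrow> ('a \<Rightarrow> real) \<Rightarrow> bool" where
  "geodesically_convex_on X f \<longleftrightarrow>
     (\<forall>x y G. minimizing_geodesic G x y \<and> G ` {0..1} \<subseteq> X \<longrightarrow>
        (\<forall>t\<in>{0..1}. f (G t) \<le> (1 - t) * f x + t * f y))"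

definition locally_lipschitz_at :: "('a::metric_space \<Rightarrow> 'b::metric_space) \<Rightarrow> 'a \<Rightarrow> bool" where
  "locally_lipschitz_at f x \<longleftrightarrow> (\<exists>r>0. \<exists>L. L-lipschitz_on (ball x r) f)"

text \<open>Gradients are taken in the ambient space, so \<open>f\<close> has to be given on a neighbourhood of \<open>x\<close>
  and not only on the sphere.\<close>

definition clarke_subdiff :: "('a::euclidean_space \<Rightarrow> real) \<Rightarrow> 'a \<Rightarrow> 'a set" where
  "clarke_subdiff f x =
     convex hull {\<xi>. \<exists>y g. y \<longlonglongrightarrow> x \<and> (\<forall>k::nat. GDERIV f (y k) :> g k) \<and> g \<longlonglongrightarrow> \<xi>}"

text \<open>\<open>\<xi> - (x \<bullet> \<xi>) x\<close> is \<open>(I - x x\<^sup>T) \<xi>\<close>.\<close>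

definition riem_clarke_subdiff :: "('a::euclidean_space \<Rightarrow> real) \<Rightarrow> 'a \<Rightarrow> 'a set" where
  "riem_clarke_subdiff f x = (\<lambda>\<xi>. \<xi> - (x \<bullet> \<xi>) *\<^sub>R x) ` clarke_subdiff f x"

text \<open>The Clarke subdifferential is only meaningful for locally Lipschitz functions (otherwise it may
  be empty, making the condition vacuous), so this standing assumption is part of the definition.\<close>

definition rga_on :: "real \<Rightarrow> 'a::euclidean_space set \<Rightarrow> 'a \<Rightarrow> ('a \<Rightarrow> real) \<Rightarrow> bool" where
  "rga_on \<mu> X xs f \<longleftrightarrow>
     (\<forall>x\<in>X. locally_lipschitz_at f x \<and>
        (\<forall>g\<in>riem_clarke_subdiff f x.
           (x \<noteq> xs \<longrightarrow> g \<noteq> 0) \<and> g \<bullet> xs \<le> - \<mu> * sin (sphere_angle x xs) * norm g))"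

definition relu :: "real \<Rightarrow> real" where
  "relu s = max s 0"

definition ternary_unif :: "(real ^ 'n) pmf" where
  "ternary_unif = pmf_of_set {z. \<forall>i. z $ i \<in> {-1, 0, 1}}"

text \<open>The formula is used on the whole ambient space; the restriction to the unit sphere comes from
  the sets on which the properties above are stated.\<close>

definition relu_loss :: "real ^ 'n \<Rightarrow> real ^ 'n \<Rightarrow> real" where
  "relu_loss xs x =
     measure_pmf.expectation ternary_unif (\<lambda>z. 1/2 * (relu (x \<bullet> z) - relu (xs \<bullet> z))\<^sup>2)"

end

theory Submission
  imports Defs
begin

text \<open>Write \<open>E\<close> for the expectation over \<open>z\<close> and \<open>e\<close> for the basis vector \<open>x\<^sup>*\<close>, whose index
  is \<open>k\<close>. Expanding the square and using that the law of \<open>z\<close> is symmetric with covariance \<open>2/3 I\<close>,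
  the loss is \<open>\<parallel>x\<parallel>\<^sup>2 / 6 + 1/6 - h x / 3\<close>, where
  \<open>h x = 3 E[relu (x \<bullet> z) relu (z $ k)]\<close> is convex, positively homogeneous, and globally
  Lipschitz. So on the sphere the loss is a constant minus a convex function.

  RGA. Up to the radial term, which the tangential projection removes, Clarke subgradients \<open>\<xi>\<close> of
  the loss at \<open>x\<close> correspond to ordinary subgradients \<open>s = x - 3 \<xi>\<close> of \<open>h\<close>: gradients of \<open>h\<close>
  satisfy the subgradient inequality, which survives limits and convex combinations. Homogeneity
  turns it into \<open>s \<bullet> x = h x\<close> and \<open>s \<bullet> w \<le> h w\<close> for all \<open>w\<close>. Two moment bounds on \<open>h\<close> are then
  enough: \<open>h x \<ge> x \<bullet> e\<close>, since \<open>relu t \<ge> t\<close>, and \<open>h (e + p) \<le> 1 + \<parallel>p\<parallel>\<^sup>2 / 12\<close> for \<open>p\<close>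
  orthogonal to \<open>e\<close> (\<open>relu_corr_axis_add_le\<close>). They force \<open>s\<close> to be close to \<open>e\<close> when \<open>x\<close> is,
  and \<open>tangential_part_bounds\<close> converts this into the required inequality with room to spare.

  Failure of convexity. Along the great circle from \<open>e\<close> in the diagonal direction
  \<open>u = (0, 1, \<dots>, 1) / sqrt (d - 1)\<close>, the vector \<open>z = (1, -1, \<dots>, -1)\<close> makes \<open>h\<close> have a convex
  kink at the angle \<open>\<theta> = arctan (1 / sqrt (d - 1)) < 2 / sqrt d\<close>. On a short arc centred at the
  kink, the first-order gain of the kink beats the second-order concavity of the sinusoidal terms,
  so the loss at the midpoint exceeds the mean of its values at the endpoints.\<close>

section \<open>Moments of the uniform distribution on the ternary cube\<close>

text \<open>The support of the distribution; expectations become averages over this finite set.\<close>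

definition ternary_cube :: "(real ^ 'n) set" where
  "ternary_cube = {z. \<forall>i. z $ i \<in> {-1, 0, 1}}"

lemma ternary_cubeD: "z \<in> ternary_cube \<Longrightarrow> z $ i = -1 \<or> z $ i = 0 \<or> z $ i = 1"
  by (auto simp: ternary_cube_def)

lemma finite_ternary_cube: "finite (ternary_cube :: (real ^ 'n::finite) set)"
proof -
  have "finite (vec_lambda ` (PiE UNIV (\<lambda>_::'n. {-1, 0, 1::real})))"
    by (intro finite_imageI finite_PiE) auto
  moreover have "ternary_cube \<subseteq> vec_lambda ` (PiE UNIV (\<lambda>_::'n. {-1, 0, 1::real}))"
  proof
    fix z :: "real ^ 'n" assume "z \<in> ternary_cube"
    then have "vec_nth z \<in> PiE UNIV (\<lambda>_. {-1, 0, 1})"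
      by (auto simp: ternary_cube_def PiE_def)
    then show "z \<in> vec_lambda ` (PiE UNIV (\<lambda>_::'n. {-1, 0, 1::real}))"
      by (metis image_eqI vec_nth_inverse)
  qed
  ultimately show ?thesis by (rule finite_subset[rotated])
qed

lemma card_ternary_cube_pos: "card (ternary_cube :: (real ^ 'n::finite) set) > 0"
proof -
  have "0 \<in> (ternary_cube :: (real ^ 'n) set)" by (simp add: ternary_cube_def)
  then show ?thesis using finite_ternary_cube by (metis card_gt_0_iff empty_iff)
qed

lemma expectation_ternary_unif:
  fixes g :: "real ^ 'n::finite \<Rightarrow> real"
  shows "measure_pmf.expectation ternary_unif g
    = (\<Sum>z\<in>ternary_cube. g z) / real (card (ternary_cube :: (real ^ 'n) set))"
proof -
  have "ternary_cube \<noteq> ({} :: (real ^ 'n) set)"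
    using card_ternary_cube_pos[where 'n='n] by force
  then show ?thesis
    unfolding ternary_unif_def ternary_cube_def[symmetric]
    by (simp add: integral_pmf_of_set finite_ternary_cube)
qed

lemma sum_ternary_cube_coordwise:
  fixes g :: "real ^ 'n::finite \<Rightarrow> real"
  assumes "\<And>i. inj_on (F i) {-1, 0, 1}" "\<And>i. F i ` {-1, 0, 1} \<subseteq> {-1, 0, 1::real}"
  shows "(\<Sum>z\<in>ternary_cube. g (\<chi> i. F i (z $ i))) = (\<Sum>z\<in>ternary_cube. g z)"
proof -
  let ?m = "\<lambda>z::real ^ 'n. \<chi> i. F i (z $ i)"
  have inj: "inj_on ?m ternary_cube"
  proof (rule inj_onI)
    fix z w :: "real ^ 'n"
    assume zw: "z \<in> ternary_cube" "w \<in> ternary_cube" "?m z = ?m w"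
    have "z $ i = w $ i" for i
    proof (rule inj_onD[OF assms(1)])
      show "F i (z $ i) = F i (w $ i)" using zw(3) by (simp add: vec_eq_iff)
      show "z $ i \<in> {-1, 0, 1}" "w $ i \<in> {-1, 0, 1}"
        using zw(1,2) by (simp_all add: ternary_cube_def)
    qed
    then show "z = w" by (simp add: vec_eq_iff)
  qed
  have "?m ` ternary_cube \<subseteq> ternary_cube"
    using assms(2) unfolding ternary_cube_def by (fastforce simp: image_subset_iff)
  then have "?m ` ternary_cube = ternary_cube"
    using inj finite_ternary_cube by (metis endo_inj_surj)
  then show ?thesis
    using sum.reindex[OF inj, of g] by simp
qed

text \<open>Applies \<open>F\<close> to the coordinate \<open>i\<close> and leaves the others alone.\<close>

definition map_coord :: "'n \<Rightarrow> (real \<Rightarrow> real) \<Rightarrow> real ^ 'n \<Rightarrow> real ^ 'n" where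
  "map_coord i F z = (\<chi> j. if j = i then F (z $ j) else z $ j)"

lemma map_coord_nth [simp]: "map_coord i F z $ j = (if j = i then F (z $ j) else z $ j)"
  by (simp add: map_coord_def)

text \<open>The cyclic permutation \<open>-1 \<rightarrow> 0 \<rightarrow> 1 \<rightarrow> -1\<close>. Averaging over its orbits computes the moments of
  one coordinate without a product decomposition of the cube.\<close>

definition rot3 :: "real \<Rightarrow> real" where
  "rot3 t = (if t = 1 then -1 else t + 1)"

lemma sum_ternary_cube_flip:
  fixes g :: "real ^ 'n::finite \<Rightarrow> real"
  shows "(\<Sum>z\<in>ternary_cube. g (map_coord i uminus z)) = (\<Sum>z\<in>ternary_cube. g z)"
  using sum_ternary_cube_coordwise[of "\<lambda>j. if j = i then uminus else id" g]
  by (simp add: map_coord_def if_distribR) (auto simp: inj_on_def if_distribR cong: if_cong)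

lemma sum_ternary_cube_rot:
  fixes g :: "real ^ 'n::finite \<Rightarrow> real"
  shows "(\<Sum>z\<in>ternary_cube. g (map_coord i rot3 z)) = (\<Sum>z\<in>ternary_cube. g z)"
  using sum_ternary_cube_coordwise[of "\<lambda>j. if j = i then rot3 else id" g]
  by (simp add: map_coord_def if_distribR) (auto simp: inj_on_def rot3_def if_distribR cong: if_cong)

text \<open>A weight that does not depend on the coordinate \<open>i\<close> is uncorrelated with every function of
  that coordinate.\<close>

lemma sum_ternary_cube_coord:
  fixes w :: "real ^ 'n::finite \<Rightarrow> real"
  assumes "\<And>z F. w (map_coord i F z) = w z"
  shows "(\<Sum>z\<in>ternary_cube. w z * q (z $ i))
    = (q (-1) + q 0 + q 1) / 3 * (\<Sum>z\<in>ternary_cube. w z)"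
proof -
  let ?g = "\<lambda>z. w z * q (z $ i)"
  let ?T = "\<lambda>z. map_coord i rot3 z"
  have 1: "(\<Sum>z\<in>ternary_cube. ?g (?T z)) = (\<Sum>z\<in>ternary_cube. ?g z)"
    by (rule sum_ternary_cube_rot)
  have 2: "(\<Sum>z\<in>ternary_cube. ?g (?T (?T z))) = (\<Sum>z\<in>ternary_cube. ?g z)"
    using sum_ternary_cube_rot[of "\<lambda>z. ?g (?T z)" i] 1 by simp
  have "(\<Sum>z\<in>ternary_cube. ?g z) + (\<Sum>z\<in>ternary_cube. ?g (?T z)) + (\<Sum>z\<in>ternary_cube. ?g (?T (?T z)))
      = (\<Sum>z\<in>ternary_cube. w z * (q (-1) + q 0 + q 1))"
    unfolding sum.distrib[symmetric]
  proof (rule sum.cong[OF refl])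
    fix z :: "real ^ 'n" assume "z \<in> ternary_cube"
    from ternary_cubeD[OF this, of i]
    show "?g z + ?g (?T z) + ?g (?T (?T z)) = w z * (q (-1) + q 0 + q 1)"
      by (auto simp: assms rot3_def algebra_simps)
  qed
  also have "\<dots> = (q (-1) + q 0 + q 1) * (\<Sum>z\<in>ternary_cube. w z)"
    unfolding sum_distrib_left by (intro sum.cong) (simp_all add: mult.commute)
  finally show ?thesis using 1 2 by simp
qed

text \<open>Second moments under a weight that does not depend on the coordinates in the support of \<open>p\<close>.
  It is needed with the constant weight and, for \<open>p $ k = 0\<close>, with the weight \<open>relu (z $ k)\<close>.\<close>

lemma sum_ternary_cube_square:
  fixes w :: "real ^ 'n::finite \<Rightarrow> real"
  assumes w: "\<And>z F i. p $ i \<noteq> 0 \<Longrightarrow> w (map_coord i F z) = w z"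
  shows "(\<Sum>z\<in>ternary_cube. w z * (p \<bullet> z)\<^sup>2) = 2/3 * (norm p)\<^sup>2 * (\<Sum>z\<in>ternary_cube. w z)"
proof -
  let ?W = "\<Sum>z\<in>ternary_cube. w z"
  have cross: "(\<Sum>z\<in>ternary_cube. w z * (z $ i * z $ j)) = (if i = j then 2/3 * ?W else 0)"
    if "p $ i \<noteq> 0" for i j
  proof (cases "i = j")
    case True
    then show ?thesis
      using sum_ternary_cube_coord[of w i "\<lambda>t. t * t"] w[OF that] by simp
  next
    case False
    have "(\<Sum>z\<in>ternary_cube. w z * (z $ i * z $ j)) = (\<Sum>z\<in>ternary_cube. - (w z * (z $ i * z $ j)))"
      using sum_ternary_cube_flip[of "\<lambda>z. w z * (z $ i * z $ j)" i] w[OF that] False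
      by simp
    then show ?thesis using False by (simp add: sum_negf)
  qed
  have "(\<Sum>z\<in>ternary_cube. w z * (p \<bullet> z)\<^sup>2)
      = (\<Sum>z\<in>ternary_cube. \<Sum>i\<in>UNIV. \<Sum>j\<in>UNIV. p $ i * p $ j * (w z * (z $ i * z $ j)))"
    by (simp add: inner_vec_def power2_eq_square sum_product sum_distrib_left mult_ac)
  also have "\<dots> = (\<Sum>i\<in>UNIV. \<Sum>z\<in>ternary_cube. \<Sum>j\<in>UNIV. p $ i * p $ j * (w z * (z $ i * z $ j)))"
    by (rule sum.swap)
  also have "\<dots> = (\<Sum>i\<in>UNIV. \<Sum>j\<in>UNIV. p $ i * p $ j * (\<Sum>z\<in>ternary_cube. w z * (z $ i * z $ j)))"
    by (intro sum.cong refl) (subst sum.swap, simp add: sum_distrib_left)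
  also have "\<dots> = (\<Sum>i\<in>UNIV. \<Sum>j\<in>UNIV. if i = j then p $ i * p $ j * (2/3 * ?W) else 0)"
    by (intro sum.cong refl) (use cross in force)
  also have "\<dots> = (\<Sum>i\<in>UNIV. p $ i * p $ i) * (2/3 * ?W)"
    unfolding sum_distrib_right by (intro sum.cong refl) simp
  also have "(\<Sum>i\<in>UNIV. p $ i * p $ i) = (norm p)\<^sup>2"
    unfolding power2_norm_eq_inner by (simp add: inner_vec_def)
  finally show ?thesis by simp
qed

lemma sum_relu_coord:
  "(\<Sum>z\<in>(ternary_cube :: (real ^ 'n::finite) set). relu (z $ k))
    = real (card (ternary_cube :: (real ^ 'n) set)) / 3"
  using sum_ternary_cube_coord[of "\<lambda>_::real^'n. 1" k relu] by (simp add: relu_def)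

lemma sum_relu_coord_inner:
  fixes x :: "real ^ 'n::finite"
  shows "(\<Sum>z\<in>ternary_cube. (x \<bullet> z) * relu (z $ k))
    = x $ k * real (card (ternary_cube :: (real ^ 'n) set)) / 3"
proof -
  let ?N = "real (card (ternary_cube :: (real ^ 'n) set))"
  have "(\<Sum>z\<in>(ternary_cube :: (real ^ 'n) set). z $ i * relu (z $ k)) = (if i = k then ?N / 3 else 0)" for i
  proof (cases "i = k")
    case True
    then show ?thesis
      using sum_ternary_cube_coord[of "\<lambda>_::real^'n. 1" k "\<lambda>t. t * relu t"] by (simp add: relu_def)
  next
    case False
    then show ?thesis
      using sum_ternary_cube_coord[of "\<lambda>z::real^'n. relu (z $ k)" i "\<lambda>t. t"]
      by (simp add: mult.commute)
  qed
  note m = this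
  have "(\<Sum>z\<in>ternary_cube. (x \<bullet> z) * relu (z $ k))
      = (\<Sum>z\<in>ternary_cube. \<Sum>i\<in>UNIV. x $ i * (z $ i * relu (z $ k)))"
    by (simp add: inner_vec_def sum_distrib_right mult.assoc)
  also have "\<dots> = (\<Sum>i\<in>UNIV. \<Sum>z\<in>ternary_cube. x $ i * (z $ i * relu (z $ k)))"
    by (rule sum.swap)
  also have "\<dots> = (\<Sum>i\<in>UNIV. x $ i * (if i = k then ?N / 3 else 0))"
    by (simp only: sum_distrib_left[symmetric] m)
  also have "\<dots> = x $ k * ?N / 3"
    by (simp add: if_distrib cong: if_cong)
  finally show ?thesis .
qed

lemma sum_ternary_cube_uminus:
  fixes g :: "real ^ 'n::finite \<Rightarrow> real"
  shows "(\<Sum>z\<in>ternary_cube. g (- z)) = (\<Sum>z\<in>ternary_cube. g z)"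
proof -
  have "(\<chi> i. - z $ i) = - z" for z :: "real ^ 'n" by (simp add: vec_eq_iff)
  then show ?thesis
    using sum_ternary_cube_coordwise[of "\<lambda>j. uminus" g] by (simp add: inj_on_def)
qed

section \<open>The correlation part of the loss\<close>

text \<open>The correlation of the two neurons with weights \<open>x\<close> and \<open>axis k 1\<close>. The factor 3 makes it
  the expectation of \<open>relu (x \<bullet> z)\<close> conditioned on \<open>z $ k = 1\<close>.\<close>

definition relu_corr :: "'n::finite \<Rightarrow> real ^ 'n \<Rightarrow> real" where
  "relu_corr k x = 3 * measure_pmf.expectation ternary_unif (\<lambda>z. relu (x \<bullet> z) * relu (z $ k))"

lemma relu_corr_sum:
  fixes x :: "real ^ 'n::finite"
  shows "relu_corr k x = 3 / real (card (ternary_cube :: (real ^ 'n) set))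
      * (\<Sum>z\<in>ternary_cube. relu (x \<bullet> z) * relu (z $ k))"
  by (simp add: relu_corr_def expectation_ternary_unif)

lemma relu_loss_eq:
  fixes x :: "real ^ 'n::finite"
  shows "relu_loss (axis k 1) x = (norm x)\<^sup>2 / 6 + 1/6 - relu_corr k x / 3"
proof -
  let ?N = "real (card (ternary_cube :: (real ^ 'n) set))"
  have N: "?N > 0" using card_ternary_cube_pos[where 'n='n] by simp
  have half: "(\<Sum>z\<in>ternary_cube. (relu (y \<bullet> z))\<^sup>2) = (norm y)\<^sup>2 / 3 * ?N" for y :: "real ^ 'n"
  proof -
    have "(\<Sum>z\<in>ternary_cube. (relu (y \<bullet> z))\<^sup>2) + (\<Sum>z\<in>ternary_cube. (relu (y \<bullet> (- z)))\<^sup>2)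
        = (\<Sum>z\<in>ternary_cube. 1 * (y \<bullet> z)\<^sup>2)"
      unfolding sum.distrib[symmetric]
      by (intro sum.cong refl) (auto simp: relu_def max_def)
    moreover have "(\<Sum>z\<in>ternary_cube. (relu (y \<bullet> (- z)))\<^sup>2) = (\<Sum>z\<in>ternary_cube. (relu (y \<bullet> z))\<^sup>2)"
      by (rule sum_ternary_cube_uminus)
    ultimately show ?thesis
      using sum_ternary_cube_square[of y "\<lambda>_. 1"] by simp
  qed
  have "relu_loss (axis k 1) x * ?N
      = (\<Sum>z\<in>ternary_cube. 1/2 * (relu (x \<bullet> z) - relu (axis k 1 \<bullet> z))\<^sup>2)"
    using N unfolding relu_loss_def expectation_ternary_unif by simp
  also have "\<dots> = (\<Sum>z\<in>ternary_cube. 1/2 * (relu (x \<bullet> z))\<^sup>2 + 1/2 * (relu (axis k 1 \<bullet> z))\<^sup>2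
        - relu (x \<bullet> z) * relu (z $ k))"
    by (intro sum.cong refl) (simp add: inner_axis' power2_diff field_simps)
  also have "\<dots> = 1/2 * ((norm x)\<^sup>2 / 3 * ?N) + 1/2 * ((norm (axis k 1 :: real ^ 'n))\<^sup>2 / 3 * ?N)
      - (\<Sum>z\<in>ternary_cube. relu (x \<bullet> z) * relu (z $ k))"
    by (simp only: sum.distrib sum_subtractf sum_distrib_left[symmetric] half)
  also have "(\<Sum>z\<in>ternary_cube. relu (x \<bullet> z) * relu (z $ k)) = relu_corr k x / 3 * ?N"
    using N by (simp add: relu_corr_sum)
  finally have "relu_loss (axis k 1) x * ?N = ((norm x)\<^sup>2 / 6 + 1/6 - relu_corr k x / 3) * ?N"
    by (simp add: field_simps)
  then show ?thesis using N by simp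
qed

lemma relu_corr_scaleR: "a \<ge> 0 \<Longrightarrow> relu_corr k (a *\<^sub>R x) = a * relu_corr k x"
proof -
  assume a: "a \<ge> 0"
  have "relu (a * t) = a * relu t" for t
    using a by (auto simp: relu_def max_def mult_le_0_iff zero_le_mult_iff)
  then show ?thesis
    unfolding relu_corr_sum by (simp add: sum_distrib_left[symmetric] mult.assoc)
qed

lemma relu_corr_convex: "convex_on UNIV (relu_corr (k :: 'n::finite))"
proof (rule convex_onI)
  fix t :: real and x y :: "real ^ 'n"
  assume t: "0 < t" "t < 1"
  let ?N = "real (card (ternary_cube :: (real ^ 'n) set))"
  have "(\<Sum>z\<in>ternary_cube. relu (((1 - t) *\<^sub>R x + t *\<^sub>R y) \<bullet> z) * relu (z $ k))
      \<le> (\<Sum>z\<in>ternary_cube. (1 - t) * (relu (x \<bullet> z) * relu (z $ k)) + t * (relu (y \<bullet> z) * relu (z $ k)))"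
  proof (rule sum_mono)
    fix z :: "real ^ 'n"
    have "relu ((1 - t) * a + t * b) \<le> (1 - t) * relu a + t * relu b" for a b
    proof -
      have "(1 - t) * a \<le> (1 - t) * relu a" "t * b \<le> t * relu b"
        using t by (auto simp: relu_def intro!: mult_left_mono)
      moreover have "0 \<le> (1 - t) * relu a" "0 \<le> t * relu b" using t by (auto simp: relu_def)
      ultimately show ?thesis by (simp add: relu_def[of "_ + _"])
    qed
    from mult_right_mono[OF this, of "relu (z $ k)" "x \<bullet> z" "y \<bullet> z"]
    show "relu (((1 - t) *\<^sub>R x + t *\<^sub>R y) \<bullet> z) * relu (z $ k)
        \<le> (1 - t) * (relu (x \<bullet> z) * relu (z $ k)) + t * (relu (y \<bullet> z) * relu (z $ k))"
      by (simp add: inner_left_distrib relu_def[of "z $ k"] algebra_simps)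
  qed
  then have "relu_corr k ((1 - t) *\<^sub>R x + t *\<^sub>R y)
      \<le> 3 / ?N * (\<Sum>z\<in>ternary_cube. (1 - t) * (relu (x \<bullet> z) * relu (z $ k)) + t * (relu (y \<bullet> z) * relu (z $ k)))"
    unfolding relu_corr_sum by (intro mult_left_mono) auto
  also have "\<dots> = (1 - t) * relu_corr k x + t * relu_corr k y"
    unfolding relu_corr_sum by (simp only: sum.distrib sum_distrib_left[symmetric] distrib_left mult.left_commute)
  finally show "relu_corr k ((1 - t) *\<^sub>R x + t *\<^sub>R y) \<le> (1 - t) * relu_corr k x + t * relu_corr k y" .
qed simp

lemma relu_corr_ge:
  fixes x :: "real ^ 'n::finite"
  shows "x $ k \<le> relu_corr k x"
proof -
  let ?N = "real (card (ternary_cube :: (real ^ 'n) set))"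
  have N: "?N > 0" using card_ternary_cube_pos[where 'n='n] by simp
  have "(\<Sum>z\<in>ternary_cube. (x \<bullet> z) * relu (z $ k)) \<le> (\<Sum>z\<in>ternary_cube. relu (x \<bullet> z) * relu (z $ k))"
    by (intro sum_mono mult_right_mono) (auto simp: relu_def)
  then have "x $ k * ?N / 3 \<le> (\<Sum>z\<in>ternary_cube. relu (x \<bullet> z) * relu (z $ k))"
    by (simp only: sum_relu_coord_inner)
  from mult_left_mono[OF this, of "3 / ?N"] N show ?thesis unfolding relu_corr_sum by simp
qed

text \<open>Since \<open>z $ k = 1\<close> wherever the weight is non-zero, the argument of the outer \<open>relu\<close> is
  \<open>1 + p \<bullet> z\<close>. Pairing \<open>z\<close> with its reflection in the \<open>k\<close>-axis reduces the bound to the scalar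
  inequality \<open>relu (1 + t) + relu (1 - t) \<le> 2 + t\<^sup>2 / 4\<close>.\<close>

lemma relu_corr_axis_add_le:
  fixes p :: "real ^ 'n::finite"
  assumes p: "p $ k = 0"
  shows "relu_corr k (axis k 1 + p) \<le> 1 + (norm p)\<^sup>2 / 12"
proof -
  let ?N = "real (card (ternary_cube :: (real ^ 'n) set))"
  have N: "?N > 0" using card_ternary_cube_pos[where 'n='n] by simp
  let ?g = "\<lambda>z. relu ((axis k 1 + p) \<bullet> z) * relu (z $ k)"
  let ?F = "\<lambda>z::real ^ 'n. \<chi> i. (if i = k then id else uminus) (z $ i)"
  have F: "p \<bullet> ?F z = - (p \<bullet> z)" for z
    unfolding inner_vec_def sum_negf[symmetric] using p by (intro sum.cong) auto
  have "(\<Sum>z\<in>ternary_cube. ?g (?F z)) = (\<Sum>z\<in>ternary_cube. ?g z)"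
    by (rule sum_ternary_cube_coordwise) (auto simp: inj_on_def)
  then have "2 * (\<Sum>z\<in>ternary_cube. ?g z) = (\<Sum>z\<in>ternary_cube. ?g z + ?g (?F z))"
    by (simp add: sum.distrib)
  also have "\<dots> \<le> (\<Sum>z\<in>ternary_cube. 2 * relu (z $ k) + 1/4 * (relu (z $ k) * (p \<bullet> z)\<^sup>2))"
  proof (rule sum_mono)
    fix z :: "real ^ 'n" assume z: "z \<in> ternary_cube"
    have key: "relu (1 + t) + relu (1 - t) \<le> 2 + t\<^sup>2 / 4" for t
    proof -
      have "0 \<le> (t - 2)\<^sup>2" "0 \<le> (t + 2)\<^sup>2" "0 \<le> t\<^sup>2" by auto
      then show ?thesis by (auto simp: relu_def max_def power2_eq_square algebra_simps)
    qed
    have "?F z $ k = z $ k" by simp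
    then show "?g z + ?g (?F z) \<le> 2 * relu (z $ k) + 1/4 * (relu (z $ k) * (p \<bullet> z)\<^sup>2)"
      using ternary_cubeD[OF z, of k] key[of "p \<bullet> z"]
      by (auto simp: inner_left_distrib inner_axis' F relu_def[of 1] relu_def[of "-1"] relu_def[of 0])
  qed
  also have "\<dots> = 2 * (?N / 3) + 1/4 * (2/3 * (norm p)\<^sup>2 * (?N / 3))"
  proof -
    have "(\<Sum>z\<in>ternary_cube. relu (z $ k) * (p \<bullet> z)\<^sup>2) = 2/3 * (norm p)\<^sup>2 * (?N / 3)"
      using sum_ternary_cube_square[of p "\<lambda>z. relu (z $ k)"] p by (force simp: sum_relu_coord)
    then show ?thesis
      by (simp only: sum.distrib sum_distrib_left[symmetric] sum_relu_coord)
  qed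
  finally have "(\<Sum>z\<in>ternary_cube. ?g z) \<le> (1 + (norm p)\<^sup>2 / 12) * (?N / 3)"
    by (simp add: field_simps)
  from mult_left_mono[OF this, of "3 / ?N"] N show ?thesis unfolding relu_corr_sum by simp
qed

lemma relu_corr_lipschitz:
  "\<exists>L\<ge>0. \<forall>x y. \<bar>relu_corr k x - relu_corr k y\<bar> \<le> L * norm (x - y :: real ^ 'n::finite)"
proof -
  let ?N = "real (card (ternary_cube :: (real ^ 'n) set))"
  let ?L = "3 / ?N * (\<Sum>z\<in>(ternary_cube :: (real ^ 'n) set). norm z * relu (z $ k))"
  have "\<bar>relu_corr k x - relu_corr k y\<bar> \<le> ?L * norm (x - y)" for x y :: "real ^ 'n"
  proof -
    have "\<bar>(\<Sum>z\<in>ternary_cube. relu (x \<bullet> z) * relu (z $ k)) - (\<Sum>z\<in>ternary_cube. relu (y \<bullet> z) * relu (z $ k))\<bar>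
       \<le> (\<Sum>z\<in>ternary_cube. norm (x - y) * (norm z * relu (z $ k)))"
      unfolding sum_subtractf[symmetric]
    proof (rule order_trans[OF sum_abs], rule sum_mono)
      fix z :: "real ^ 'n"
      have "\<bar>relu (x \<bullet> z) - relu (y \<bullet> z)\<bar> \<le> \<bar>(x - y) \<bullet> z\<bar>"
        by (auto simp: relu_def max_def inner_diff_left)
      also have "\<dots> \<le> norm (x - y) * norm z" by (rule Cauchy_Schwarz_ineq2)
      finally have "\<bar>relu (x \<bullet> z) - relu (y \<bullet> z)\<bar> * relu (z $ k) \<le> norm (x - y) * norm z * relu (z $ k)"
        by (intro mult_right_mono) (auto simp: relu_def)
      then show "\<bar>relu (x \<bullet> z) * relu (z $ k) - relu (y \<bullet> z) * relu (z $ k)\<bar>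
          \<le> norm (x - y) * (norm z * relu (z $ k))"
        by (simp add: left_diff_distrib[symmetric] abs_mult mult.assoc relu_def[of "z $ k"])
    qed
    from mult_left_mono[OF this, of "3 / ?N"] show ?thesis
      unfolding relu_corr_sum right_diff_distrib[symmetric] abs_mult sum_distrib_left[symmetric]
      by (simp add: ac_simps)
  qed
  moreover have "?L \<ge> 0" by (intro mult_nonneg_nonneg sum_nonneg) (auto simp: relu_def)
  ultimately show ?thesis by blast
qed

lemma locally_lipschitz_relu_loss:
  fixes x :: "real ^ 'n::finite"
  shows "locally_lipschitz_at (relu_loss (axis k 1)) x"
proof -
  obtain L where L: "L \<ge> 0" "\<And>x y::real ^ 'n. \<bar>relu_corr k x - relu_corr k y\<bar> \<le> L * norm (x - y)"
    using relu_corr_lipschitz by metis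
  let ?R = "norm x + 1"
  have "(2 * ?R / 6 + L / 3)-lipschitz_on (ball x 1) (relu_loss (axis k 1))"
  proof (rule lipschitz_onI)
    fix y w assume yw: "y \<in> ball x 1" "w \<in> ball x 1"
    have R: "norm y \<le> ?R" "norm w \<le> ?R"
      using yw norm_triangle_sub[of y x] norm_triangle_sub[of w x]
      by (auto simp: dist_norm norm_minus_commute)
    have "\<bar>(norm y)\<^sup>2 - (norm w)\<^sup>2\<bar> = \<bar>norm y - norm w\<bar> * (norm y + norm w)"
      by (simp add: power2_eq_square square_diff_square_factored abs_mult mult.commute)
    also have "\<dots> \<le> norm (y - w) * (2 * ?R)"
      using R by (intro mult_mono norm_triangle_ineq3) auto
    finally have a: "\<bar>(norm y)\<^sup>2 - (norm w)\<^sup>2\<bar> \<le> norm (y - w) * (2 * ?R)" .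
    have "\<bar>relu_loss (axis k 1) y - relu_loss (axis k 1) w\<bar>
        \<le> \<bar>(norm y)\<^sup>2 - (norm w)\<^sup>2\<bar> / 6 + \<bar>relu_corr k y - relu_corr k w\<bar> / 3"
      unfolding relu_loss_eq by argo
    also have "\<dots> \<le> norm (y - w) * (2 * ?R) / 6 + L * norm (y - w) / 3"
      using a L(2)[of y w] by (intro add_mono divide_right_mono) auto
    finally show "dist (relu_loss (axis k 1) y) (relu_loss (axis k 1) w) \<le> (2 * ?R / 6 + L / 3) * dist y w"
      by (simp add: dist_norm algebra_simps)
  qed (use L(1) in auto)
  then show ?thesis unfolding locally_lipschitz_at_def by (metis zero_less_one)
qed

section \<open>Clarke subgradients of the loss\<close>

lemma convex_GDERIV_subgradient:
  fixes f :: "'a::real_inner \<Rightarrow> real"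
  assumes f: "convex_on UNIV f" and D: "GDERIV f y :> s"
  shows "f y + s \<bullet> (w - y) \<le> f w"
proof -
  let ?l = "\<lambda>t::real. y + t *\<^sub>R (w - y)"
  have "convex_on UNIV (\<lambda>t. f (?l t))"
  proof (rule convex_onI)
    fix t a b :: real assume "0 < t" "t < 1"
    moreover have "?l ((1 - t) *\<^sub>R a + t *\<^sub>R b) = (1 - t) *\<^sub>R ?l a + t *\<^sub>R ?l b"
      by (simp add: algebra_simps)
    ultimately show "f (?l ((1 - t) *\<^sub>R a + t *\<^sub>R b)) \<le> (1 - t) * f (?l a) + t * f (?l b)"
      using convex_onD[OF f, of t "?l a" "?l b"] by simp
  qed simp
  moreover have "((\<lambda>t. f (?l t)) has_real_derivative s \<bullet> (w - y)) (at 0)"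
  proof -
    have "(f has_derivative (\<lambda>h. h \<bullet> s)) (at (?l 0))" using D by (simp add: gderiv_def)
    moreover have "(?l has_derivative (\<lambda>t. t *\<^sub>R (w - y))) (at 0)"
      by (auto intro!: derivative_eq_intros)
    ultimately have "((\<lambda>t. f (?l t)) has_derivative (\<lambda>t. (t *\<^sub>R (w - y)) \<bullet> s)) (at 0)"
      by (rule has_derivative_compose[rotated])
    then show ?thesis
      by (simp add: has_field_derivative_def inner_commute mult_commute_abs)
  qed
  ultimately have "f (?l 1) - f (?l 0) \<ge> (s \<bullet> (w - y)) * (1 - 0)"
    by (intro convex_on_imp_above_tangent[where A = UNIV]) auto
  then show ?thesis by simp
qed

text \<open>That is, \<open>x - 3 \<xi>\<close> is a subgradient of \<open>relu_corr k\<close> at \<open>x\<close>. For fixed \<open>w\<close> the inequality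
  defines a half-space of vectors \<open>\<xi>\<close>, so it is enough to check it on limits of gradients.\<close>

lemma clarke_subdiff_relu_loss:
  fixes x :: "real ^ 'n::finite"
  assumes "\<xi> \<in> clarke_subdiff (relu_loss (axis k 1)) x"
  shows "relu_corr k x + (x - 3 *\<^sub>R \<xi>) \<bullet> (w - x) \<le> relu_corr k w"
proof -
  let ?h = "relu_corr k" and ?f = "relu_loss (axis k 1)"
  let ?K = "{\<xi>. ?h x + (x - 3 *\<^sub>R \<xi>) \<bullet> (w - x) \<le> ?h w}"
  obtain L where L: "L \<ge> 0" "\<And>x y::real ^ 'n. \<bar>?h x - ?h y\<bar> \<le> L * norm (x - y)"
    using relu_corr_lipschitz by metis
  have cont: "continuous_on UNIV ?h"
    using L by (intro lipschitz_on_continuous_on[of L] lipschitz_onI) (auto simp: dist_norm)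
  have "?K = {\<xi>. (w - x) \<bullet> \<xi> \<ge> (?h x + x \<bullet> (w - x) - ?h w) / 3}"
  proof -
    have *: "(x - 3 *\<^sub>R \<xi>) \<bullet> (w - x) = x \<bullet> (w - x) - 3 * ((w - x) \<bullet> \<xi>)" for \<xi>
      by (simp add: inner_diff_left[of x] inner_commute[of \<xi>])
    have "relu_corr k x + (x - 3 *\<^sub>R \<xi>) \<bullet> (w - x) \<le> relu_corr k w
        \<longleftrightarrow> (w - x) \<bullet> \<xi> \<ge> (relu_corr k x + x \<bullet> (w - x) - relu_corr k w) / 3" for \<xi>
    proof -
      have "a + (b - 3 * c) \<le> h \<longleftrightarrow> c \<ge> (a + b - h) / 3" for a b c h :: real by auto
      then show ?thesis unfolding * .
    qed
    then show ?thesis by blast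
  qed
  then have "convex ?K" by (simp only: convex_halfspace_ge)
  moreover have "{\<xi>. \<exists>y g. y \<longlonglongrightarrow> x \<and> (\<forall>j::nat. GDERIV ?f (y j) :> g j) \<and> g \<longlonglongrightarrow> \<xi>} \<subseteq> ?K"
  proof clarify
    fix \<xi> y g
    assume y: "y \<longlonglongrightarrow> x" and D: "\<forall>j::nat. GDERIV ?f (y j) :> g j" and g: "g \<longlonglongrightarrow> \<xi>"
    have "?h (y j) + (y j - 3 *\<^sub>R g j) \<bullet> (w - y j) \<le> ?h w" for j
    proof (rule convex_GDERIV_subgradient[OF relu_corr_convex])
      have "?h = (\<lambda>x. (x \<bullet> x) / 2 + 1/2 - 3 * ?f x)"
        by (rule ext) (simp add: relu_loss_eq power2_norm_eq_inner)
      moreover have "((\<lambda>x. (x \<bullet> x) / 2 + 1/2 - 3 * ?f x) has_derivative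
            (\<lambda>v. v \<bullet> (y j - 3 *\<^sub>R g j))) (at (y j))"
        using D[rule_format, of j] unfolding gderiv_def
        by (auto intro!: derivative_eq_intros simp: inner_diff_right inner_commute)
      ultimately show "GDERIV ?h (y j) :> (y j - 3 *\<^sub>R g j)"
        unfolding gderiv_def by simp
    qed
    moreover have "(\<lambda>j. ?h (y j) + (y j - 3 *\<^sub>R g j) \<bullet> (w - y j))
        \<longlonglongrightarrow> ?h x + (x - 3 *\<^sub>R \<xi>) \<bullet> (w - x)"
      by (intro tendsto_intros y g continuous_on_tendsto_compose[OF cont y]) auto
    ultimately show "?h x + (x - 3 *\<^sub>R \<xi>) \<bullet> (w - x) \<le> ?h w"
      by (intro LIMSEQ_le_const2) auto
  qed
  ultimately have "clarke_subdiff ?f x \<subseteq> ?K"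
    unfolding clarke_subdiff_def by (rule hull_minimal[rotated])
  then show ?thesis using assms by blast
qed

section \<open>The RGA property near the target\<close>

text \<open>Split \<open>x = c e + y\<close> and \<open>s = s1 e + q\<close> orthogonally and put \<open>t = \<parallel>y\<parallel> / c\<close>, the tangent of
  the angle between \<open>x\<close> and \<open>e\<close>. The lower bound on \<open>s \<bullet> x\<close> and the upper bound at
  \<open>p = y / c + q\<close> together give \<open>\<parallel>q\<parallel> \<le> t / 2\<close>, hence \<open>s1 \<ge> 1 - t\<^sup>2 / 2\<close>. As
  \<open>sqrt (1 - c\<^sup>2)\<close> is the sine of that angle, the tangential part of \<open>s\<close> has norm of the order of
  the sine, and its component along \<open>e\<close> is of the order of the square of the sine.\<close>

lemma tangential_part_bounds:
  fixes x e s :: "'a::real_inner"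
  assumes x: "norm x = 1" and e: "norm e = 1" and c: "x \<bullet> e \<ge> 9/10"
    and sx: "x \<bullet> e \<le> s \<bullet> x"
    and sp: "\<And>p. p \<bullet> e = 0 \<Longrightarrow> s \<bullet> (e + p) \<le> 1 + (norm p)\<^sup>2 / 12"
  shows "(s - (x \<bullet> s) *\<^sub>R x) \<bullet> e \<ge> (1 - (x \<bullet> e)\<^sup>2) / 3"
    and "norm (s - (x \<bullet> s) *\<^sub>R x) \<le> 2 * sqrt (1 - (x \<bullet> e)\<^sup>2)"
proof -
  define c where "c = x \<bullet> e"
  define y where "y = x - c *\<^sub>R e"
  define s1 where "s1 = s \<bullet> e"
  define q where "q = s - s1 *\<^sub>R e"
  define r where "r = norm y"
  have ee: "e \<bullet> e = 1" and xx: "x \<bullet> x = 1" using x e by (simp_all add: norm_eq_1)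
  have c9: "c \<ge> 9/10" using assms by (simp add: c_def)
  have ye: "y \<bullet> e = 0" "e \<bullet> y = 0" and qe: "q \<bullet> e = 0" "e \<bullet> q = 0"
    by (simp_all add: y_def q_def c_def s1_def inner_diff_left inner_diff_right ee inner_commute)
  have xy: "x = c *\<^sub>R e + y" and sq: "s = s1 *\<^sub>R e + q" by (simp_all add: y_def q_def)
  have r2: "r\<^sup>2 = 1 - c\<^sup>2"
    using xx unfolding r_def power2_norm_eq_inner xy
    by (simp add: inner_add_left inner_add_right ee ye power2_eq_square)
  have r0: "r \<ge> 0" by (simp add: r_def)
  then have r: "r = sqrt (1 - (x \<bullet> e)\<^sup>2)" using r2 by (simp add: c_def[symmetric] real_sqrt_unique)
  have sxe: "s \<bullet> x = c * s1 + q \<bullet> y"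
    unfolding xy by (subst sq) (simp add: inner_add_left inner_add_right ee ye qe)
  define t where "t = r / c"
  have t0: "t \<ge> 0" using r0 c9 by (simp add: t_def)
  have t2: "t\<^sup>2 \<le> 1/4"
  proof -
    have "(9/10)\<^sup>2 \<le> c\<^sup>2" using c9 by (intro power_mono) auto
    then have "1 - c\<^sup>2 \<le> 1/4 * c\<^sup>2" by (simp add: power2_eq_square)
    then show ?thesis using c9 r2 by (simp add: t_def power_divide divide_le_eq)
  qed
  have low: "1 \<le> s1 + q \<bullet> y / c"
    using sx c9 unfolding c_def[symmetric] sxe by (simp add: field_simps)
  have Q: "norm q \<le> t / 2"
  proof (rule ccontr)
    assume "\<not> norm q \<le> t / 2"
    then have lt: "t + norm q < 3 * norm q" by simp
    \<comment> \<open>The shift by \<open>y / c\<close> makes \<open>e + p = x / c + q\<close>, where \<open>s \<bullet> (x / c) \<ge> 1\<close> is known.\<close>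
    define p where "p = (1 / c) *\<^sub>R y + q"
    have "p \<bullet> e = 0" by (simp add: p_def inner_add_left ye qe)
    from sp[OF this] have "s1 + q \<bullet> y / c + q \<bullet> q \<le> 1 + (norm p)\<^sup>2 / 12"
      by (subst (asm) (1) sq) (simp add: p_def inner_add_left inner_add_right ee ye qe)
    then have 1: "(norm q)\<^sup>2 \<le> (norm p)\<^sup>2 / 12"
      using low by (simp add: power2_norm_eq_inner)
    have "norm p \<le> t + norm q"
      using norm_triangle_ineq[of "(1 / c) *\<^sub>R y" q] c9 by (simp add: p_def t_def r_def)
    then have "norm p < 3 * norm q" using lt by simp
    then have "(norm p)\<^sup>2 < (3 * norm q)\<^sup>2" by (intro power_strict_mono) auto
    then show False using 1 by (simp add: power_mult_distrib) (smt (verit) zero_le_power2)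
  qed
  have qy: "q \<bullet> y \<le> t / 2 * r"
    using norm_cauchy_schwarz[of q y] mult_right_mono[OF Q r0] by (simp add: r_def)
  have "q \<bullet> y / c \<le> t / 2 * r / c" using qy c9 by (intro divide_right_mono) auto
  also have "t / 2 * r / c = t\<^sup>2 / 2" by (simp add: t_def power2_eq_square)
  finally have s1_low: "s1 \<ge> 7/8" using low t2 by simp
  have s1_up: "s1 \<le> 1" using sp[of 0] by (simp add: s1_def)
  have "(s - (x \<bullet> s) *\<^sub>R x) \<bullet> e = s1 - (c * s1 + q \<bullet> y) * c"
    by (simp add: inner_diff_left s1_def[symmetric] c_def[symmetric] inner_commute[of x s] sxe)
  also have "\<dots> = s1 * r\<^sup>2 - c * (q \<bullet> y)" unfolding r2 by (simp add: power2_eq_square algebra_simps)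
  also have "\<dots> \<ge> s1 * r\<^sup>2 - c * (t / 2 * r)" using qy c9 by (simp add: mult_left_mono)
  also have "s1 * r\<^sup>2 - c * (t / 2 * r) = (s1 - 1/2) * r\<^sup>2"
    using c9 by (simp add: t_def power2_eq_square algebra_simps)
  finally have "(s - (x \<bullet> s) *\<^sub>R x) \<bullet> e \<ge> (s1 - 1/2) * r\<^sup>2" .
  moreover have "(s1 - 1/2) * r\<^sup>2 \<ge> 1/3 * r\<^sup>2" using s1_low by (intro mult_right_mono) auto
  ultimately show "(s - (x \<bullet> s) *\<^sub>R x) \<bullet> e \<ge> (1 - (x \<bullet> e)\<^sup>2) / 3"
    using r2 by (simp add: c_def)
  have proj: "(norm (v - (x \<bullet> v) *\<^sub>R x))\<^sup>2 = (norm v)\<^sup>2 - (x \<bullet> v)\<^sup>2" for v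
    unfolding power2_norm_eq_inner
    by (simp add: inner_diff_left inner_diff_right xx inner_commute power2_eq_square algebra_simps)
  have "(norm (e - (x \<bullet> e) *\<^sub>R x))\<^sup>2 = r\<^sup>2" using proj[of e] e by (simp add: r2 c_def)
  then have Pe: "norm (e - (x \<bullet> e) *\<^sub>R x) = r" using r0 by (simp add: power2_eq_iff_nonneg)
  have Pq: "norm (q - (x \<bullet> q) *\<^sub>R x) \<le> norm q"
  proof (rule power2_le_imp_le)
    show "(norm (q - (x \<bullet> q) *\<^sub>R x))\<^sup>2 \<le> (norm q)\<^sup>2"
      unfolding proj using zero_le_power2[of "x \<bullet> q"] by linarith
  qed simp
  have "s - (x \<bullet> s) *\<^sub>R x = s1 *\<^sub>R (e - (x \<bullet> e) *\<^sub>R x) + (q - (x \<bullet> q) *\<^sub>R x)"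
    by (simp add: q_def inner_diff_right algebra_simps)
  then have "norm (s - (x \<bullet> s) *\<^sub>R x) \<le> s1 * r + norm q"
    using norm_triangle_ineq[of "s1 *\<^sub>R (e - (x \<bullet> e) *\<^sub>R x)" "q - (x \<bullet> q) *\<^sub>R x"] Pe Pq s1_low by simp
  also have "\<dots> \<le> 1 * r + t / 2" using Q s1_up r0 by (intro add_mono mult_right_mono) auto
  also have "t / 2 \<le> r"
  proof -
    have "r * 1 \<le> r * (2 * c)" using r0 c9 by (intro mult_left_mono) auto
    then show ?thesis using c9 by (simp add: t_def field_simps)
  qed
  finally show "norm (s - (x \<bullet> s) *\<^sub>R x) \<le> 2 * sqrt (1 - (x \<bullet> e)\<^sup>2)" using r by simp
qed

lemma rga_on_relu_loss:
  fixes k :: "'n::finite"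
  shows "rga_on (sqrt 3 / 72) (spherical_cap (axis k 1) (arctan (sqrt 3 / 36))) (axis k 1)
    (relu_loss (axis k 1 :: real ^ 'n))"
proof -
  let ?e = "axis k 1 :: real ^ 'n"
  let ?f = "relu_loss ?e"
  have "(g \<noteq> 0 \<or> x = ?e) \<and> g \<bullet> ?e \<le> - (sqrt 3 / 72) * sin (sphere_angle x ?e) * norm g"
    if x: "x \<in> spherical_cap ?e (arctan (sqrt 3 / 36))" and g: "g \<in> riem_clarke_subdiff ?f x" for x g
  proof -
    let ?c = "x \<bullet> ?e"
    let ?r = "sqrt (1 - ?c\<^sup>2)"
    have nx: "norm x = 1" and ang: "arccos ?c \<le> arctan (sqrt 3 / 36)"
      using x by (auto simp: spherical_cap_def sphere_angle_def)
    have ne: "norm ?e = 1" by simp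
    have arctan_lt_pi: "arctan (sqrt 3 / 36) < pi"
      using arctan_ubound[of "sqrt 3 / 36"] pi_gt_zero by linarith
    have c1: "\<bar>?c\<bar> \<le> 1" using Cauchy_Schwarz_ineq2[of x ?e] nx ne by simp
    have c9: "?c \<ge> 9/10"
    proof -
      have "cos (arctan (sqrt 3 / 36)) \<le> cos (arccos ?c)"
        using ang c1 arctan_lt_pi
        by (intro cos_monotone_0_pi_le) (auto intro: arccos_lbound)
      moreover have "9/10 \<le> cos (arctan (sqrt 3 / 36))"
      proof -
        have "sqrt (1 + (sqrt 3 / 36)\<^sup>2) \<le> 10/9"
          by (intro real_le_lsqrt) (auto simp: power_divide power2_eq_square)
        moreover have "sqrt (1 + (sqrt 3 / 36)\<^sup>2) > 0"
          by (smt (verit) real_sqrt_gt_zero zero_le_power2)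
        ultimately show ?thesis unfolding cos_arctan by (simp add: field_simps)
      qed
      ultimately show ?thesis using c1 by (simp add: cos_arccos_abs)
    qed
    have sin_r: "sin (sphere_angle x ?e) = ?r"
      using c1 by (simp add: sphere_angle_def sin_arccos_abs)
    obtain \<xi> where \<xi>: "\<xi> \<in> clarke_subdiff ?f x" and g_eq: "g = \<xi> - (x \<bullet> \<xi>) *\<^sub>R x"
      using g by (auto simp: riem_clarke_subdiff_def)
    \<comment> \<open>The tangential part of \<open>s\<close> is \<open>- 3 g\<close>, because that of \<open>x\<close> vanishes.\<close>
    define s where "s = x - 3 *\<^sub>R \<xi>"
    have sub: "relu_corr k x + s \<bullet> (w - x) \<le> relu_corr k w" for w
      using clarke_subdiff_relu_loss[OF \<xi>] by (simp add: s_def)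
    \<comment> \<open>Homogeneity: compare with the points \<open>2 x\<close> and \<open>0\<close> of the ray through \<open>x\<close>.\<close>
    have "s \<bullet> x = relu_corr k x"
      using sub[of "2 *\<^sub>R x"] sub[of "0 *\<^sub>R x"] relu_corr_scaleR[of 2 k x] relu_corr_scaleR[of 0 k x]
      by (simp add: inner_diff_right)
    then have sw: "s \<bullet> w \<le> relu_corr k w" for w
      using sub[of w] by (simp add: inner_diff_right)
    have "?c \<le> s \<bullet> x"
      using relu_corr_ge[of x k] \<open>s \<bullet> x = _\<close> by (simp add: inner_axis)
    moreover have "s \<bullet> (?e + p) \<le> 1 + (norm p)\<^sup>2 / 12" if "p \<bullet> ?e = 0" for p
      using sw[of "?e + p"] relu_corr_axis_add_le[of p k] that by (simp add: inner_axis)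
    ultimately have A: "(s - (x \<bullet> s) *\<^sub>R x) \<bullet> ?e \<ge> (1 - ?c\<^sup>2) / 3"
      and B: "norm (s - (x \<bullet> s) *\<^sub>R x) \<le> 2 * ?r"
      using tangential_part_bounds[OF nx ne c9] by blast+
    have "x \<bullet> x = 1" using nx by (simp add: norm_eq_1)
    then have G: "s - (x \<bullet> s) *\<^sub>R x = - 3 *\<^sub>R g"
      by (simp add: s_def g_eq inner_diff_right algebra_simps)
    have r2: "?r\<^sup>2 = 1 - ?c\<^sup>2" using c1 by (simp add: abs_square_le_1)
    have r0: "?r \<ge> 0" using c1 by (simp add: abs_square_le_1)
    have A': "g \<bullet> ?e \<le> - ?r\<^sup>2 / 9" using A unfolding G r2 by simp
    have "norm (- 3 *\<^sub>R g) = 3 * norm g" by simp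
    then have B': "norm g \<le> ?r" using B r0 norm_ge_zero[of g] unfolding G by linarith
    have "sqrt 3 / 72 * ?r * norm g \<le> 1/9 * ?r * ?r"
      using B' r0 real_le_lsqrt[of 8 3] by (intro mult_mono) auto
    then have "g \<bullet> ?e \<le> - (sqrt 3 / 72) * ?r * norm g"
      using A' unfolding power2_eq_square[of ?r] by linarith
    moreover have "x = ?e" if "g = 0"
    proof -
      have "?r\<^sup>2 \<le> 0" using A' that by simp
      then have "?c\<^sup>2 \<ge> 1" unfolding r2 by simp
      then have "1 \<le> ?c" using c9 power2_le_imp_le[of 1 ?c] by simp
      then have "?c = 1" using c1 by linarith
      then have "(norm (x - ?e))\<^sup>2 = 0"
        using \<open>x \<bullet> x = 1\<close> unfolding power2_norm_eq_inner
        by (simp add: inner_diff_left inner_diff_right inner_commute inner_axis)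
      then show ?thesis by simp
    qed
    ultimately show ?thesis using sin_r by auto
  qed
  then show ?thesis
    unfolding rga_on_def using locally_lipschitz_relu_loss by blast
qed

section \<open>Failure of geodesic convexity\<close>

text \<open>Here \<open>P\<close> parametrizes the great circle through \<open>e\<close> in the diagonal direction \<open>u\<close> by the angle
  from \<open>e\<close>, and \<open>V\<close> is its velocity. The point \<open>P \<theta>\<close> is orthogonal to \<open>z0 = (1, -1, \<dots>, -1)\<close>, while
  \<open>P \<theta> \<bullet> z \<ge> 0\<close> for every \<open>z\<close> in the cube with \<open>z $ k = 1\<close>.\<close>

lemma not_geodesically_convex_relu_loss:
  fixes k :: "'n::finite"
  assumes d2: "CARD('n) \<ge> 2"
  shows "\<not> geodesically_convex_on (spherical_cap (axis k 1) (2 / sqrt (real CARD('n))))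
    (relu_loss (axis k 1 :: real ^ 'n))"
proof
  let ?e = "axis k 1 :: real ^ 'n"
  let ?f = "relu_loss ?e"
  let ?d = "real CARD('n)"
  let ?N = "real (card (ternary_cube :: (real ^ 'n) set))"
  assume conv: "geodesically_convex_on (spherical_cap ?e (2 / sqrt ?d)) ?f"
  have N: "?N > 0" using card_ternary_cube_pos[where 'n='n] by simp
  define m where "m = sqrt (?d - 1)"
  have d: "?d \<ge> 2" using d2 by simp
  have m2: "m * m = ?d - 1" and m0: "m > 0" using d by (simp_all add: m_def)
  define u :: "real ^ 'n" where "u = (\<chi> i. if i = k then 0 else 1 / m)"
  have sum_off: "(\<Sum>i\<in>UNIV. if i = k then 0 else a) = (?d - 1) * a" for a :: real
    using d2 by (simp add: sum.If_cases Compl_eq_Diff_UNIV of_nat_diff)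
  have uu: "u \<bullet> u = 1"
  proof -
    have "u \<bullet> u = (\<Sum>i\<in>UNIV. if i = k then 0 else 1 / m * (1 / m))"
      by (auto simp: inner_vec_def u_def intro!: sum.cong)
    then show ?thesis unfolding sum_off using m2[symmetric] m0 by simp
  qed
  have eu: "?e \<bullet> u = 0" "u \<bullet> ?e = 0" and ee: "?e \<bullet> ?e = 1"
    by (simp_all add: inner_axis inner_axis' u_def)
  define P where "P \<phi> = cos \<phi> *\<^sub>R ?e + sin \<phi> *\<^sub>R u" for \<phi> :: real
  define V where "V \<phi> = - sin \<phi> *\<^sub>R ?e + cos \<phi> *\<^sub>R u" for \<phi> :: real
  have PP: "P a \<bullet> P b = cos (a - b)" for a b
    by (simp add: P_def inner_add_left inner_add_right eu ee uu cos_diff)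
  have nP: "norm (P a) = 1" for a using PP[of a a] by (simp add: norm_eq_1)
  have P_cap: "P a \<in> spherical_cap ?e \<rho>" if "0 \<le> a" "a \<le> pi" "a \<le> \<rho>" for a \<rho>
  proof -
    have "P a \<bullet> ?e = cos a" by (simp add: P_def inner_add_left eu ee)
    then show ?thesis using that nP by (simp add: spherical_cap_def sphere_angle_def arccos_cos)
  qed
  have P_add: "P (a + b) = cos b *\<^sub>R P a + sin b *\<^sub>R V a" for a b
    by (simp add: P_def V_def cos_add sin_add algebra_simps)
  define \<theta> where "\<theta> = arctan (1 / m)"
  have th0: "0 < \<theta>" "\<theta> < pi / 2" using m0 arctan_ubound by (auto simp: \<theta>_def)
  have th_cap: "\<theta> < 2 / sqrt ?d"
  proof -
    have "sqrt ?d < sqrt (4 * (?d - 1))" using d by (intro real_sqrt_less_mono) simp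
    then have "sqrt ?d < 2 * m" unfolding m_def real_sqrt_mult by simp
    then have "1 / m < 2 / sqrt ?d" using m0 d by (simp add: field_simps)
    then show ?thesis using arctan_le_self[of "1 / m"] m0 by (simp add: \<theta>_def)
  qed
  have sd: "sqrt (1 + (1 / m)\<^sup>2) = sqrt ?d / m"
  proof -
    have "1 + (1 / m)\<^sup>2 = ?d / m\<^sup>2" using m2 m0 by (simp add: power2_eq_square field_simps)
    then show ?thesis using m0 by (simp add: real_sqrt_divide)
  qed
  have cth: "cos \<theta> = m / sqrt ?d" and sth: "sin \<theta> = 1 / sqrt ?d"
    using m0 by (simp_all add: \<theta>_def cos_arctan sin_arctan sd)
  define z0 :: "real ^ 'n" where "z0 = (\<chi> i. if i = k then 1 else -1)"
  have z0: "z0 \<in> ternary_cube" and z0k: "z0 $ k = 1" by (simp_all add: z0_def ternary_cube_def)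
  have u_z: "u \<bullet> z \<ge> - m" if "z \<in> ternary_cube" for z
  proof -
    have "(\<Sum>i\<in>UNIV. if i = k then 0 else - 1 / m) \<le> u \<bullet> z"
      unfolding inner_vec_def
    proof (rule sum_mono)
      fix i
      have "- 1 \<le> z $ i" using ternary_cubeD[OF that, of i] by auto
      then show "(if i = k then 0 else - 1 / m) \<le> u $ i \<bullet> z $ i"
        using m0 divide_right_mono[of "- 1" "z $ i" m] by (simp add: u_def)
    qed
    moreover have "(?d - 1) * (- 1 / m) = - m" using m0 unfolding m2[symmetric] by simp
    ultimately show ?thesis unfolding sum_off by simp
  qed
  have u_z0: "u \<bullet> z0 = - m"
  proof -
    have "u \<bullet> z0 = (\<Sum>i\<in>UNIV. if i = k then 0 else - 1 / m)"
      by (auto simp: inner_vec_def u_def z0_def intro!: sum.cong)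
    then show ?thesis unfolding sum_off m2[symmetric] using m0 by simp
  qed
  have sqd: "sqrt ?d > 0" using d by simp
  have P_z: "P \<theta> \<bullet> z \<ge> 0" if "z \<in> ternary_cube" "z $ k = 1" for z
  proof -
    have "P \<theta> \<bullet> z = (m + u \<bullet> z) / sqrt ?d"
      using that by (simp add: P_def inner_add_left inner_axis' cth sth add_divide_distrib)
    then show ?thesis using u_z[OF that(1)] sqd by simp
  qed
  have P_z0: "P \<theta> \<bullet> z0 = 0"
    by (simp add: P_def inner_add_left inner_axis' cth sth u_z0 z0k)
  have V_z0: "V \<theta> \<bullet> z0 = - sqrt ?d"
  proof -
    have "V \<theta> \<bullet> z0 = - (1 + m * m) / sqrt ?d"
      by (simp add: V_def inner_diff_left inner_axis' cth sth u_z0 z0k) (simp add: field_simps)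
    also have "\<dots> = - sqrt ?d" unfolding m2 using d by (simp add: real_div_sqrt)
    finally show ?thesis .
  qed
  define B where "B = relu_corr k (P \<theta>)"
  define a where "a = 3 / ?N * sqrt ?d"
  have a0: "a > 0" using N sqd by (simp add: a_def)
  \<comment> \<open>The kink contributes \<open>a sin h\<close>, of first order in \<open>h\<close>; the curvature of the remaining terms
    costs only \<open>2 B (1 - cos h)\<close>, of second order.\<close>
  have "\<exists>D>0. \<forall>h>0. h < D \<longrightarrow> (\<lambda>t. a * sin t - 2 * B * (1 - cos t)) 0 < (\<lambda>t. a * sin t - 2 * B * (1 - cos t)) (0 + h)"
    using a0 by (intro DERIV_pos_inc_right[where l = a]) (auto intro!: derivative_eq_intros)
  then obtain D where D: "D > 0" "\<And>h. 0 < h \<Longrightarrow> h < D \<Longrightarrow> 2 * B * (1 - cos h) < a * sin h"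
    by auto
  define \<epsilon> where "\<epsilon> = Min {D / 2, \<theta>, pi / 2 - \<theta>, 2 / sqrt ?d - \<theta>, 1}"
  have eps: "0 < \<epsilon>" "\<epsilon> < D" "\<epsilon> \<le> \<theta>" "\<theta> + \<epsilon> \<le> pi / 2" "\<theta> + \<epsilon> \<le> 2 / sqrt ?d" "\<epsilon> \<le> 1"
  proof -
    show "0 < \<epsilon>" using D(1) th0 th_cap by (simp add: \<epsilon>_def)
    have "\<epsilon> \<le> D / 2" "\<epsilon> \<le> \<theta>" "\<epsilon> \<le> pi / 2 - \<theta>" "\<epsilon> \<le> 2 / sqrt ?d - \<theta>" "\<epsilon> \<le> 1"
      unfolding \<epsilon>_def by (rule Min_le; simp)+
    then show "\<epsilon> < D" "\<epsilon> \<le> \<theta>" "\<theta> + \<epsilon> \<le> pi / 2" "\<theta> + \<epsilon> \<le> 2 / sqrt ?d" "\<epsilon> \<le> 1"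
      using D(1) by linarith+
  qed
  let ?X = "P (\<theta> - \<epsilon>)" and ?Y = "P (\<theta> + \<epsilon>)"
  let ?G = "\<lambda>t. P (\<theta> - \<epsilon> + t * (2 * \<epsilon>))"
  have ang: "sphere_angle ?X ?Y = 2 * \<epsilon>"
  proof -
    have "?X \<bullet> ?Y = cos (2 * \<epsilon>)" using cos_minus[of "2 * \<epsilon>"] by (simp add: PP)
    then show ?thesis using eps pi_gt3 by (simp add: sphere_angle_def arccos_cos)
  qed
  have geo: "minimizing_geodesic ?G ?X ?Y"
    unfolding minimizing_geodesic_def ang
  proof (intro conjI exI[of _ "V (\<theta> - \<epsilon>)"] ballI)
    have "V b \<bullet> V b = 1" for b
      by (simp add: V_def inner_diff_left inner_diff_right eu ee uu flip: power2_eq_square)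
    then show "norm (V (\<theta> - \<epsilon>)) = 1" by (simp add: norm_eq_1)
    show "V (\<theta> - \<epsilon>) \<bullet> P (\<theta> - \<epsilon>) = 0"
      by (simp add: V_def P_def inner_diff_left inner_add_right eu ee uu)
  qed (auto simp: nP P_add[symmetric] algebra_simps)
  have "?G ` {0..1} \<subseteq> spherical_cap ?e (2 / sqrt ?d)"
  proof clarify
    fix t :: real assume t: "t \<in> {0..1}"
    have "0 \<le> t * (2 * \<epsilon>)" "t * (2 * \<epsilon>) \<le> 1 * (2 * \<epsilon>)"
      using t eps(1) by (auto intro: mult_right_mono)
    then have "0 \<le> \<theta> - \<epsilon> + t * (2 * \<epsilon>)" "\<theta> - \<epsilon> + t * (2 * \<epsilon>) \<le> pi"
        "\<theta> - \<epsilon> + t * (2 * \<epsilon>) \<le> 2 / sqrt ?d"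
      using eps pi_gt_zero by linarith+
    then show "?G t \<in> spherical_cap ?e (2 / sqrt ?d)" by (rule P_cap)
  qed
  then have "\<forall>t\<in>{0..1}. ?f (?G t) \<le> (1 - t) * ?f ?X + t * ?f ?Y"
    using conv[unfolded geodesically_convex_on_def, rule_format, of ?G ?X ?Y] geo by blast
  from bspec[OF this, of "1/2"] have "?f (?G (1/2)) \<le> (1 - 1/2) * ?f ?X + 1/2 * ?f ?Y"
    by simp
  then have conc: "relu_corr k ?X + relu_corr k ?Y \<le> 2 * B"
    by (simp add: relu_loss_eq nP B_def field_simps)
  have XY: "?X = cos \<epsilon> *\<^sub>R P \<theta> - sin \<epsilon> *\<^sub>R V \<theta>" "?Y = cos \<epsilon> *\<^sub>R P \<theta> + sin \<epsilon> *\<^sub>R V \<theta>"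
    using P_add[of \<theta> "- \<epsilon>"] P_add[of \<theta> \<epsilon>] by simp_all
  \<comment> \<open>Termwise, \<open>relu t \<ge> t\<close> at both endpoints and \<open>?X + ?Y = 2 cos \<epsilon> P \<theta>\<close>; the vector \<open>z0\<close>, on which
    \<open>P \<theta>\<close> vanishes, gives the strict gain.\<close>
  have "(\<Sum>z\<in>ternary_cube. 2 * cos \<epsilon> * (relu (P \<theta> \<bullet> z) * relu (z $ k)) + (if z = z0 then sqrt ?d * sin \<epsilon> else 0))
      \<le> (\<Sum>z\<in>ternary_cube. relu (?X \<bullet> z) * relu (z $ k) + relu (?Y \<bullet> z) * relu (z $ k))"
  proof (rule sum_mono)
    fix z :: "real ^ 'n" assume z: "z \<in> ternary_cube"
    have "z $ k = 1 \<or> relu (z $ k) = 0"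
      using ternary_cubeD[OF z, of k] by (auto simp: relu_def)
    then consider "z = z0" | "z \<noteq> z0" "z $ k = 1" | "z \<noteq> z0" "relu (z $ k) = 0"
      by blast
    then show "2 * cos \<epsilon> * (relu (P \<theta> \<bullet> z) * relu (z $ k)) + (if z = z0 then sqrt ?d * sin \<epsilon> else 0)
      \<le> relu (?X \<bullet> z) * relu (z $ k) + relu (?Y \<bullet> z) * relu (z $ k)"
    proof cases
      case 1
      have "?X \<bullet> z0 = sqrt ?d * sin \<epsilon>" by (simp add: XY inner_diff_left P_z0 V_z0)
      then show ?thesis using 1 P_z0 z0k by (simp add: relu_def)
    next
      case 2
      have "?X \<bullet> z + ?Y \<bullet> z = 2 * cos \<epsilon> * (P \<theta> \<bullet> z)"
        by (simp add: XY inner_diff_left inner_add_left)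
      then show ?thesis using 2 P_z[OF z 2(2)] by (simp add: relu_def)
    next
      case 3
      then show ?thesis by simp
    qed
  qed
  also have "(\<Sum>z\<in>ternary_cube. 2 * cos \<epsilon> * (relu (P \<theta> \<bullet> z) * relu (z $ k)) + (if z = z0 then sqrt ?d * sin \<epsilon> else 0))
      = 2 * cos \<epsilon> * (\<Sum>z\<in>ternary_cube. relu (P \<theta> \<bullet> z) * relu (z $ k)) + sqrt ?d * sin \<epsilon>"
    using z0 by (simp add: sum.distrib sum_distrib_left[symmetric] sum.delta finite_ternary_cube)
  finally have *: "2 * cos \<epsilon> * (\<Sum>z\<in>ternary_cube. relu (P \<theta> \<bullet> z) * relu (z $ k)) + sqrt ?d * sin \<epsilon>
      \<le> (\<Sum>z\<in>ternary_cube. relu (?X \<bullet> z) * relu (z $ k)) + (\<Sum>z\<in>ternary_cube. relu (?Y \<bullet> z) * relu (z $ k))"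
    by (simp add: sum.distrib)
  have "2 * cos \<epsilon> * B + a * sin \<epsilon> \<le> relu_corr k ?X + relu_corr k ?Y"
    using mult_left_mono[OF *, of "3 / ?N"] N
    by (simp add: B_def a_def relu_corr_sum distrib_left mult_ac)
  with conc D(2)[OF eps(1,2)] show False by (simp add: algebra_simps)
qed

theorem lemma5p31:
  fixes k :: "'n::finite" and xs :: "real ^ 'n"
  assumes "CARD('n) \<ge> 2"
    and "xs = axis k 1"
  shows "\<not> geodesically_convex_on (spherical_cap xs (2 / sqrt (real CARD('n)))) (relu_loss xs)
    \<and> rga_on (sqrt 3 / 72) (spherical_cap xs (arctan (sqrt 3 / 36))) xs (relu_loss xs)"
  using not_geodesically_convex_relu_loss[OF assms(1)] rga_on_relu_loss assms(2) by blast

end
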